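(* Let $H$ be a graph of maximum degree $d\geq 1$, let $x_1,x_2$ be two distinct leaves of $H$, and let $y_1,y_2$, respectively, be the unique neighbors of $x_1,x_2$ in $H$. Assume that at least one of the following holds: (a) $y_1=y_2$; (b) $y_1y_2\in E(H)$ and $x_1,x_2$ are at distance three in $H$; (c) $\alpha(H[N_H(y_1)])+\alpha(H[N_H(y_2)])\geq d+2$. Then $H$ is deletion-normal.
   Context: All graphs are finite, without loops or parallel edges. A leaf is a vertex of degree one. $N_H(v)$ is the set of neighbors of $v$ in $H$, $H[X]$ is the subgraph induced by $X$, and $\alpha(F)$ is the maximum cardinality of a stable (independent) set in $F$. A graph $G$ is $H$-free if it has no induced subgraph isomorphic to $H$. A graph $G$ is $H$-deletion-saturated if $G$ is $H$-free, $E(G)\neq\varnothing$, and for every edge $e\in E(G)$ the graph $G-e$ is not $H$-free. A graph $H$ is deletion-normal if there exists a (finite) $H$-deletion-saturated graph. *)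

theory Defs
  imports Main "HOL-Library.Extended_Nat"
begin

record 'a ugraph =
  verts :: "'a set"
  edges :: "'a set set"

definition simple_graph :: "'a ugraph \<Rightarrow> bool" where
  "simple_graph G \<longleftrightarrow> finite (verts G) \<and> (\<forall>e\<in>edges G. e \<subseteq> verts G \<and> card e = 2)"

definition neighbors :: "'a ugraph \<Rightarrow> 'a \<Rightarrow> 'a set" where
  "neighbors G v = {u \<in> verts G. {v, u} \<in> edges G}"

definition degree :: "'a ugraph \<Rightarrow> 'a \<Rightarrow> nat" where
  "degree G v = card (neighbors G v)"

(* Only meaningful when the vertex set is finite and nonempty. *)
definition max_degree :: "'a ugraph \<Rightarrow> nat" where
  "max_degree G = Max (degree G ` verts G)"

definition leaf :: "'a ugraph \<Rightarrow> 'a \<Rightarrow> bool" where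
  "leaf G v \<longleftrightarrow> v \<in> verts G \<and> degree G v = 1"

(* G[X]; only used for X contained in the vertex set of G. *)
definition induced_subgraph :: "'a ugraph \<Rightarrow> 'a set \<Rightarrow> 'a ugraph" where
  "induced_subgraph G X = \<lparr>verts = X, edges = {e \<in> edges G. e \<subseteq> X}\<rparr>"

definition stable_set :: "'a ugraph \<Rightarrow> 'a set \<Rightarrow> bool" where
  "stable_set G S \<longleftrightarrow> S \<subseteq> verts G \<and> (\<forall>u\<in>S. \<forall>v\<in>S. {u, v} \<notin> edges G)"

definition stability_number :: "'a ugraph \<Rightarrow> nat" where
  "stability_number G = Max (card ` {S. stable_set G S})"

(* A path is given by its list of vertices, so its length is one less than that of the list. *)
definition path_between :: "'a ugraph \<Rightarrow> 'a \<Rightarrow> 'a \<Rightarrow> 'a list \<Rightarrow> bool" where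
  "path_between G u v p \<longleftrightarrow>
     p \<noteq> [] \<and> hd p = u \<and> last p = v \<and> distinct p \<and> set p \<subseteq> verts G \<and>
     (\<forall>i. Suc i < length p \<longrightarrow> {p ! i, p ! Suc i} \<in> edges G)"

(* The infimum over the empty set is \<infinity>: the distance between different components. *)
definition distance :: "'a ugraph \<Rightarrow> 'a \<Rightarrow> 'a \<Rightarrow> enat" where
  "distance G u v = (INF p\<in>{p. path_between G u v p}. enat (length p - 1))"

definition isomorphic :: "'a ugraph \<Rightarrow> 'b ugraph \<Rightarrow> bool" where
  "isomorphic G H \<longleftrightarrow>
     (\<exists>f. bij_betw f (verts G) (verts H) \<and>
          (\<forall>u\<in>verts G. \<forall>v\<in>verts G. {u, v} \<in> edges G \<longleftrightarrow> {f u, f v} \<in> edges H))"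

definition induced_free :: "'b ugraph \<Rightarrow> 'a ugraph \<Rightarrow> bool" where
  "induced_free H G \<longleftrightarrow> \<not> (\<exists>X \<subseteq> verts G. isomorphic (induced_subgraph G X) H)"

definition delete_edge :: "'a ugraph \<Rightarrow> 'a set \<Rightarrow> 'a ugraph" where
  "delete_edge G e = \<lparr>verts = verts G, edges = edges G - {e}\<rparr>"

definition deletion_saturated :: "'b ugraph \<Rightarrow> 'a ugraph \<Rightarrow> bool" where
  "deletion_saturated H G \<longleftrightarrow>
     induced_free H G \<and> edges G \<noteq> {} \<and> (\<forall>e\<in>edges G. \<not> induced_free H (delete_edge G e))"

(* Every finite graph has an isomorphic copy whose vertices are natural numbers, so letting G
   range over graphs on nat loses no finite graph, whatever the vertex type of H. *)
definition deletion_normal :: "'b ugraph \<Rightarrow> bool" where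
  "deletion_normal H \<longleftrightarrow> (\<exists>G :: nat ugraph. simple_graph G \<and> deletion_saturated H G)"

end

theory Submission
  imports Defs "HOL-Library.Nat_Bijection"
begin

text \<open>
  Every graph of maximum degree at most \<open>d \<ge> 2\<close> is an intersection graph of \<open>d\<close>-element sets: give a
  vertex its incident edges and pad with points that belong to it alone. Let \<open>N + 1\<close> be the least
  number of points for which \<open>H\<close> has such a model, and let \<open>G\<close> be the graph of all \<open>d\<close>-subsets of an
  \<open>N\<close>-element set, two of them adjacent when they meet. By minimality \<open>G\<close> is \<open>H\<close>-free. Deleting an
  edge \<open>AB\<close> of \<open>G\<close> permits one pair of meeting sets, \<open>A\<close> and \<open>B\<close>, to represent nonadjacent
  vertices. The claim is that this always saves a point, so that \<open>G - AB\<close> contains \<open>H\<close>.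

  In a model \<open>f\<close> of \<open>H\<close> on \<open>N + 1\<close> points the leaves \<open>x1\<close>, \<open>x2\<close> have disjoint sets, which together
  fill a region \<open>U\<close> of \<open>2d\<close> points. Of the other vertices only \<open>y1\<close> and \<open>y2\<close> have points in \<open>U\<close>. As \<open>A\<close> and
  \<open>B\<close> meet, they fit into a region \<open>F\<close> of \<open>2d - 1\<close> points. Exchange \<open>U\<close> for \<open>F\<close>, keep everything
  outside of \<open>U\<close>, and represent \<open>x1\<close> by \<open>A\<close> and \<open>x2\<close> by \<open>B\<close>. It remains to choose new traces on
  \<open>F\<close> for \<open>y1\<close> and \<open>y2\<close>, with as many points, \<open>a1\<close> and \<open>a2\<close>, as their old traces on \<open>U\<close>
  (\<open>intersection_model_surgery\<close>).

  If \<open>y1 = y2\<close>, any trace that contains points of both \<open>A - B\<close> and \<open>B - A\<close> will do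
  (\<open>model_after_deletion_common_neighbor\<close>). If \<open>y1 \<noteq> y2\<close>, the trace of \<open>y1\<close> must meet \<open>A\<close> and avoid
  \<open>B\<close>, the other way round for \<open>y2\<close>, and unless \<open>y1\<close> and \<open>y2\<close> are adjacent the traces must be
  disjoint. Since \<open>F - B\<close> and \<open>F - A\<close> have \<open>d - 1\<close> points, such traces exist if \<open>a1, a2 < d\<close>,
  and disjoint ones if moreover \<open>a1 + a2 \<le> d\<close> (\<open>traces_exist\<close>). If \<open>y1\<close> and \<open>y2\<close> are adjacent then
  \<open>a1, a2 < d\<close>, because \<open>y1\<close> and \<open>y2\<close> share a point outside of \<open>U\<close>. Under the hypothesis on stability numbers,
  the set of \<open>y1\<close> meets \<open>\<alpha>(H[N(y1)]) - 1\<close> pairwise disjoint sets outside of \<open>f x1\<close>, hence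
  \<open>a1 \<le> d + 1 - \<alpha>(H[N(y1)])\<close> (\<open>card_leaf_overlap_le\<close>); adding the two bounds gives
  \<open>a1 + a2 \<le> d\<close>.
\<close>

section \<open>Intersection models and the graph of all \<open>d\<close>-subsets\<close>

text \<open>
  The parameter \<open>D\<close> is a pair \<open>{A, B}\<close> of sets that counts as nonadjacent even when \<open>A\<close> and \<open>B\<close>
  meet. With \<open>D = {}\<close>, which is never of the form \<open>{f u, f v}\<close>, the model is an ordinary
  intersection representation. One notion thus serves both for \<open>G\<close> and for \<open>G\<close> minus an edge.
\<close>
definition intersection_model ::
  "'a ugraph \<Rightarrow> nat \<Rightarrow> 'b set \<Rightarrow> 'b set set \<Rightarrow> ('a \<Rightarrow> 'b set) \<Rightarrow> bool" where
  "intersection_model H d M D f \<longleftrightarrow>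
     inj_on f (verts H) \<and> (\<forall>v\<in>verts H. f v \<subseteq> M \<and> card (f v) = d) \<and>
     (\<forall>u\<in>verts H. \<forall>v\<in>verts H. u \<noteq> v \<longrightarrow>
        ({u, v} \<in> edges H \<longleftrightarrow> f u \<inter> f v \<noteq> {} \<and> {f u, f v} \<noteq> D))"

lemma intersection_modelI:
  assumes "inj_on f (verts H)"
    and "\<And>v. v \<in> verts H \<Longrightarrow> f v \<subseteq> M" and "\<And>v. v \<in> verts H \<Longrightarrow> card (f v) = d"
    and "\<And>u v. u \<in> verts H \<Longrightarrow> v \<in> verts H \<Longrightarrow> u \<noteq> v \<Longrightarrow>
      {u, v} \<in> edges H \<longleftrightarrow> f u \<inter> f v \<noteq> {} \<and> {f u, f v} \<noteq> D"
  shows "intersection_model H d M D f"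
  unfolding intersection_model_def by (intro conjI ballI impI assms)

lemma intersection_modelD:
  assumes "intersection_model H d M D f"
  shows "inj_on f (verts H)"
    and "v \<in> verts H \<Longrightarrow> f v \<subseteq> M" and "v \<in> verts H \<Longrightarrow> card (f v) = d"
    and "u \<in> verts H \<Longrightarrow> v \<in> verts H \<Longrightarrow> u \<noteq> v \<Longrightarrow>
      {u, v} \<in> edges H \<longleftrightarrow> f u \<inter> f v \<noteq> {} \<and> {f u, f v} \<noteq> D"
  using assms by (simp_all add: intersection_model_def)

text \<open>
  The sets are encoded as numbers, by their binary expansions, because \<^const>\<open>deletion_normal\<close> asks
  for a graph on the natural numbers. Without the encoding this is the union of the generalized
  Johnson graphs on \<open>d\<close>-subsets for the intersection sizes \<open>1, \<dots>, d - 1\<close>.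
\<close>
definition intersecting_graph :: "nat \<Rightarrow> nat \<Rightarrow> nat ugraph" where
  "intersecting_graph d N =
     \<lparr>verts = set_encode ` {S. S \<subseteq> {..<N} \<and> card S = d},
      edges = {{set_encode S, set_encode T} | S T.
                 S \<subseteq> {..<N} \<and> card S = d \<and> T \<subseteq> {..<N} \<and> card T = d \<and> S \<noteq> T \<and> S \<inter> T \<noteq> {}}\<rparr>"

lemma simple_graph_edgeD:
  assumes "simple_graph H" "{u, v} \<in> edges H"
  shows "u \<in> verts H" "v \<in> verts H" "u \<noteq> v"
proof -
  have "{u, v} \<subseteq> verts H" and c: "card {u, v} = 2"
    using assms by (auto simp: simple_graph_def)
  then show "u \<in> verts H" "v \<in> verts H" by auto
  show "u \<noteq> v" using c by auto
qed

lemma not_induced_free_iff_embedding: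
  "\<not> induced_free H G \<longleftrightarrow>
     (\<exists>g. inj_on g (verts H) \<and> g ` verts H \<subseteq> verts G \<and>
          (\<forall>u\<in>verts H. \<forall>v\<in>verts H. {u, v} \<in> edges H \<longleftrightarrow> {g u, g v} \<in> edges G))"
  (is "_ \<longleftrightarrow> (\<exists>g. ?emb g)")
proof
  assume "\<not> induced_free H G"
  then obtain X h where X: "X \<subseteq> verts G" and h: "bij_betw h X (verts H)"
    and e: "\<And>u v. u \<in> X \<Longrightarrow> v \<in> X \<Longrightarrow> {u, v} \<in> edges G \<longleftrightarrow> {h u, h v} \<in> edges H"
    by (auto simp: induced_free_def isomorphic_def induced_subgraph_def)
  let ?g = "inv_into X h"
  have g: "bij_betw ?g (verts H) X" using h by (rule bij_betw_inv_into)
  have gX: "?g v \<in> X" and hg: "h (?g v) = v" if "v \<in> verts H" for v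
    using that g h by (auto simp: bij_betw_apply bij_betw_inv_into_right)
  have "?emb ?g"
    using g X e gX hg by (auto simp: bij_betw_def)
  then show "\<exists>g. ?emb g" by blast
next
  assume "\<exists>g. ?emb g"
  then obtain g where g: "?emb g" by blast
  let ?X = "g ` verts H"
  have "bij_betw (inv_into (verts H) g) ?X (verts H)"
    using g by (simp add: bij_betw_inv_into inj_on_imp_bij_betw)
  moreover have "{a, b} \<in> edges G \<longleftrightarrow>
      {inv_into (verts H) g a, inv_into (verts H) g b} \<in> edges H"
    if "a \<in> ?X" "b \<in> ?X" for a b
    using that g by (auto simp: inv_into_f_f)
  ultimately have "isomorphic (induced_subgraph G ?X) H"
    unfolding isomorphic_def induced_subgraph_def by auto
  then show "\<not> induced_free H G"
    using g unfolding induced_free_def by blast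
qed

lemma intersecting_graph_edgeE:
  assumes "e \<in> edges (intersecting_graph d N)"
  obtains S T where "e = {set_encode S, set_encode T}" "S \<subseteq> {..<N}" "card S = d"
    "T \<subseteq> {..<N}" "card T = d" "S \<noteq> T" "S \<inter> T \<noteq> {}"
  using assms unfolding intersecting_graph_def ugraph.simps
  by (elim CollectE exE conjE) (rule that; assumption)

lemma intersecting_graph_edge_iff:
  assumes S: "S \<subseteq> {..<N}" "card S = d" and T: "T \<subseteq> {..<N}" "card T = d"
  shows "{set_encode S, set_encode T} \<in> edges (intersecting_graph d N) \<longleftrightarrow> S \<noteq> T \<and> S \<inter> T \<noteq> {}"
proof
  have dec: "set_decode (set_encode S') = S'" if "S' \<subseteq> {..<N}" for S'
    using that finite_subset by fastforce
  assume "{set_encode S, set_encode T} \<in> edges (intersecting_graph d N)"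
  then obtain S' T' where *: "{set_encode S, set_encode T} = {set_encode S', set_encode T'}"
      "S' \<subseteq> {..<N}" "T' \<subseteq> {..<N}" "S' \<noteq> T'" "S' \<inter> T' \<noteq> {}"
    by (rule intersecting_graph_edgeE)
  then have "{S, T} = {S', T'}"
    using S T dec by (metis doubleton_eq_iff)
  then show "S \<noteq> T \<and> S \<inter> T \<noteq> {}" using * by (auto simp: doubleton_eq_iff)
next
  assume "S \<noteq> T \<and> S \<inter> T \<noteq> {}"
  then show "{set_encode S, set_encode T} \<in> edges (intersecting_graph d N)"
    using S T unfolding intersecting_graph_def ugraph.simps by blast
qed

text \<open>
  Induced copies of \<open>H\<close> in the graph of \<open>d\<close>-subsets are intersection models, and deletion of the
  edge \<open>AB\<close> turns into the exceptional pair \<open>D = {A, B}\<close>. As \<open>{}\<close> is not an edge, \<open>D = {}\<close> covers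
  the undamaged graph.
\<close>
lemma not_induced_free_intersecting_graph_iff:
  assumes H: "simple_graph H" and D: "D \<subseteq> Pow {..<N}"
  shows "\<not> induced_free H (delete_edge (intersecting_graph d N) (set_encode ` D)) \<longleftrightarrow>
         (\<exists>f. intersection_model H d {..<N} D f)"
proof -
  let ?G = "delete_edge (intersecting_graph d N) (set_encode ` D)"
  have fin: "finite S" if "S \<subseteq> {..<N}" for S :: "nat set"
    using that finite_subset by blast
  have pair: "set_encode ` {S, T} = set_encode ` D \<longleftrightarrow> {S, T} = D"
    if "S \<subseteq> {..<N}" "T \<subseteq> {..<N}" for S T
  proof (rule inj_on_image_eq_iff)
    show "inj_on set_encode (Pow {..<N})"
      using inj_on_set_encode by (rule inj_on_subset) (auto intro: fin)
    show "{S, T} \<subseteq> Pow {..<N}" using that by auto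
  qed (fact D)
  have adj: "{set_encode S, set_encode T} \<in> edges ?G \<longleftrightarrow> S \<noteq> T \<and> S \<inter> T \<noteq> {} \<and> {S, T} \<noteq> D"
    if "S \<subseteq> {..<N}" "card S = d" "T \<subseteq> {..<N}" "card T = d" for S T
    using intersecting_graph_edge_iff[OF that] pair[OF that(1,3)]
    by (simp add: delete_edge_def)
  have loopless: "{u, u} \<notin> edges H" for u
    using simple_graph_edgeD(3)[OF H, of u u] by blast
  let ?emb = "\<lambda>g. inj_on g (verts H) \<and> g ` verts H \<subseteq> verts ?G \<and>
      (\<forall>u\<in>verts H. \<forall>v\<in>verts H. {u, v} \<in> edges H \<longleftrightarrow> {g u, g v} \<in> edges ?G)"
  show ?thesis unfolding not_induced_free_iff_embedding
  proof
    assume "\<exists>g. ?emb g"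
    then obtain g where "?emb g" ..
    then have inj: "inj_on g (verts H)" and im: "g ` verts H \<subseteq> verts ?G"
      and e: "\<And>u v. u \<in> verts H \<Longrightarrow> v \<in> verts H \<Longrightarrow> {u, v} \<in> edges H \<longleftrightarrow> {g u, g v} \<in> edges ?G"
      by simp_all
    have "\<forall>v\<in>verts H. \<exists>S. S \<subseteq> {..<N} \<and> card S = d \<and> g v = set_encode S"
      using im by (auto simp: delete_edge_def intersecting_graph_def)
    then obtain f where
      f: "\<And>v. v \<in> verts H \<Longrightarrow> f v \<subseteq> {..<N} \<and> card (f v) = d \<and> g v = set_encode (f v)"
      by metis
    have "inj_on f (verts H)" using inj f by (auto simp: inj_on_def)
    moreover have "{u, v} \<in> edges H \<longleftrightarrow> f u \<inter> f v \<noteq> {} \<and> {f u, f v} \<noteq> D"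
      if "u \<in> verts H" "v \<in> verts H" "u \<noteq> v" for u v
    proof -
      have "f u \<noteq> f v" using \<open>inj_on f (verts H)\<close> that by (auto dest: inj_onD)
      then show ?thesis using that e[of u v] f[of u] f[of v] adj[of "f u" "f v"] by simp
    qed
    ultimately have "intersection_model H d {..<N} D f"
      using f by (intro intersection_modelI) auto
    then show "\<exists>f. intersection_model H d {..<N} D f" by blast
  next
    assume "\<exists>f. intersection_model H d {..<N} D f"
    then obtain f where model: "intersection_model H d {..<N} D f" ..
    note inj = intersection_modelD(1)[OF model] and e = intersection_modelD(4)[OF model]
    have f: "f v \<subseteq> {..<N} \<and> card (f v) = d" if "v \<in> verts H" for v
      using intersection_modelD(2,3)[OF model that] by simp
    let ?g = "\<lambda>v. set_encode (f v)"
    have "inj_on ?g (verts H)"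
      using inj f fin by (auto simp: inj_on_def set_encode_eq)
    moreover have "?g ` verts H \<subseteq> verts ?G"
      using f by (auto simp: delete_edge_def intersecting_graph_def)
    moreover have "{u, v} \<in> edges H \<longleftrightarrow> {?g u, ?g v} \<in> edges ?G"
      if "u \<in> verts H" "v \<in> verts H" for u v
    proof (cases "u = v")
      case True
      then show ?thesis using loopless adj[of "f u" "f u"] f that by simp
    next
      case False
      then have "f u \<noteq> f v" using inj that by (auto dest: inj_onD)
      then show ?thesis using False that e[of u v] f adj[of "f u" "f v"] by simp
    qed
    ultimately have "?emb ?g" by simp
    then show "\<exists>g. ?emb g" by (intro exI[where x = ?g])
  qed
qed

text \<open>
  This reduces the problem to models: none on \<open>N\<close> points, but one as soon as any two meeting sets
  may count as disjoint. The bounds on \<open>d\<close> ensure that there are two distinct meeting \<open>d\<close>-subsets.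
\<close>
lemma deletion_saturated_intersecting_graph:
  assumes H: "simple_graph H" and d: "2 \<le> d" "d < N"
    and none: "\<nexists>f. intersection_model H d {..<N} {} f"
    and pair: "\<And>A B. A \<subseteq> {..<N} \<Longrightarrow> card A = d \<Longrightarrow> B \<subseteq> {..<N} \<Longrightarrow> card B = d \<Longrightarrow> A \<noteq> B \<Longrightarrow>
      A \<inter> B \<noteq> {} \<Longrightarrow> \<exists>f. intersection_model H d {..<N} {A, B} f"
  shows "simple_graph (intersecting_graph d N)" "deletion_saturated H (intersecting_graph d N)"
proof -
  let ?G = "intersecting_graph d N"
  have ne: "set_encode S \<noteq> set_encode T" if "S \<subseteq> {..<N}" "T \<subseteq> {..<N}" "S \<noteq> T" for S T
    using that set_encode_eq finite_subset finite_lessThan by metis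
  show simple: "simple_graph ?G"
    unfolding simple_graph_def
  proof (intro conjI ballI)
    show "finite (verts ?G)" by (simp add: intersecting_graph_def)
    fix e assume "e \<in> edges ?G"
    then obtain S T where "e = {set_encode S, set_encode T}" "S \<noteq> T"
      "S \<subseteq> {..<N}" "card S = d" "T \<subseteq> {..<N}" "card T = d"
      by (rule intersecting_graph_edgeE)
    then show "e \<subseteq> verts ?G" "card e = 2"
      using ne[of S T] by (auto simp: intersecting_graph_def)
  qed
  \<comment> \<open>Deleting the non-edge \<open>{}\<close> changes nothing, so the characterization applies with \<open>D = {}\<close>.\<close>
  have "{} \<notin> edges ?G" using simple by (auto simp: simple_graph_def)
  then have "delete_edge ?G (set_encode ` {}) = ?G" by (simp add: delete_edge_def)
  then have "induced_free H ?G"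
    using not_induced_free_intersecting_graph_iff[OF H, of "{}" N d] none by auto
  moreover have "{set_encode {0..<d}, set_encode {1..<Suc d}} \<in> edges ?G"
  proof -
    have "0 \<in> {0..<d}" "0 \<notin> {1..<Suc d}" "1 \<in> {0..<d} \<inter> {1..<Suc d}" using d by auto
    then have "{0..<d} \<noteq> {1..<Suc d}" "{0..<d} \<inter> {1..<Suc d} \<noteq> {}" by blast+
    moreover have "{0..<d} \<subseteq> {..<N}" "{1..<Suc d} \<subseteq> {..<N}" using d by auto
    ultimately show ?thesis by (subst intersecting_graph_edge_iff) auto
  qed
  moreover have "\<not> induced_free H (delete_edge ?G e)" if e: "e \<in> edges ?G" for e
  proof -
    obtain A B where "e = {set_encode A, set_encode B}" and AB: "A \<subseteq> {..<N}" "card A = d"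
      "B \<subseteq> {..<N}" "card B = d" "A \<noteq> B" "A \<inter> B \<noteq> {}"
      using e by (rule intersecting_graph_edgeE)
    then have "e = set_encode ` {A, B}" by simp
    then show ?thesis
      using not_induced_free_intersecting_graph_iff[OF H, of "{A, B}" N d] AB pair[OF AB]
      by simp
  qed
  ultimately show "deletion_saturated H ?G"
    unfolding deletion_saturated_def by blast
qed

section \<open>Every graph has an intersection model\<close>

lemma degree_le_max_degree:
  assumes "simple_graph H" "v \<in> verts H"
  shows "degree H v \<le> max_degree H"
  using assms by (auto simp: max_degree_def simple_graph_def intro!: Max_ge)

lemma degree_eq_card_incident_edges:
  assumes H: "simple_graph H" and v: "v \<in> verts H"
  shows "degree H v = card {e \<in> edges H. v \<in> e}"
proof -
  have "bij_betw (\<lambda>u. {v, u}) (neighbors H v) {e \<in> edges H. v \<in> e}"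
  proof (rule bij_betw_imageI)
    show "inj_on (\<lambda>u. {v, u}) (neighbors H v)" by (auto simp: inj_on_def doubleton_eq_iff)
    show "(\<lambda>u. {v, u}) ` neighbors H v = {e \<in> edges H. v \<in> e}"
    proof (intro equalityI subsetI)
      fix e assume "e \<in> {e \<in> edges H. v \<in> e}"
      then have e: "e \<in> edges H" "v \<in> e" by auto
      then have "card e = 2" using H by (auto simp: simple_graph_def)
      then obtain u where "e = {v, u}" using e(2) by (auto simp: card_2_iff)
      then show "e \<in> (\<lambda>u. {v, u}) ` neighbors H v"
        using e simple_graph_edgeD[OF H, of v u] by (auto simp: neighbors_def)
    qed (auto simp: neighbors_def)
  qed
  then show ?thesis unfolding degree_def by (rule bij_betw_same_card)
qed

lemma intersection_model_image:
  assumes f: "intersection_model H d M {} f" and h: "inj_on h M"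
  shows "intersection_model H d (h ` M) {} (\<lambda>v. h ` f v)"
proof -
  have sub: "f v \<subseteq> M" if "v \<in> verts H" for v
    using f that by (auto simp: intersection_model_def)
  have "inj_on (\<lambda>v. h ` f v) (verts H)"
    using intersection_modelD(1)[OF f] h sub by (auto simp: inj_on_def inj_on_image_eq_iff)
  moreover have "card (h ` f v) = card (f v)" if "v \<in> verts H" for v
    using sub[OF that] h by (meson card_image inj_on_subset)
  moreover have "h ` f u \<inter> h ` f v = {} \<longleftrightarrow> f u \<inter> f v = {}" if "u \<in> verts H" "v \<in> verts H" for u v
    using inj_on_image_Int[OF h sub sub, OF that] by (metis image_is_empty)
  ultimately show ?thesis
    using f by (auto simp: intersection_model_def)
qed

text \<open>
  Two distinct vertices share at most the one edge between them, so for \<open>d \<ge> 2\<close> padding keeps the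
  sets distinct. For \<open>d = 1\<close> the two ends of an isolated edge would receive the same set.
\<close>
lemma intersection_model_exists:
  assumes H: "simple_graph H" and d: "max_degree H \<le> d" "2 \<le> d"
  shows "\<exists>N f. intersection_model H d {..<N :: nat} {} f"
proof -
  define I where "I v = {e \<in> edges H. v \<in> e}" for v
  \<comment> \<open>The left summand holds the incident edges, the right one the private padding points.\<close>
  define f :: "'a \<Rightarrow> ('a set + 'a \<times> nat) set"
    where "f v = Inl ` I v \<union> Inr ` ({v} \<times> {..<d - card (I v)})" for v
  have "edges H \<subseteq> Pow (verts H)" using H by (auto simp: simple_graph_def)
  then have finE: "finite (edges H)"
    using H by (meson finite_Pow_iff finite_subset simple_graph_def)
  have finI: "finite (I v)" for v using finE by (simp add: I_def)
  have finf: "finite (f v)" for v using finI by (simp add: f_def)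
  have card_f: "card (f v) = d" if "v \<in> verts H" for v
  proof -
    have "card (I v) \<le> d"
      using degree_le_max_degree[OF H that] degree_eq_card_incident_edges[OF H that] d
      by (simp add: I_def)
    moreover have "card (f v) = card (I v) + (d - card (I v))"
      unfolding f_def using finI
      by (subst card_Un_disjoint) (auto simp: card_image card_cartesian_product)
    ultimately show ?thesis by simp
  qed
  have Int: "f u \<inter> f v = (if {u, v} \<in> edges H then {Inl {u, v}} else {})" if "u \<noteq> v" for u v
  proof -
    have "e = {u, v}" if "e \<in> edges H" "u \<in> e" "v \<in> e" for e
    proof -
      have "card e = 2" using H that by (auto simp: simple_graph_def)
      then show ?thesis using that \<open>u \<noteq> v\<close> by (auto simp: card_2_iff)
    qed
    then have "I u \<inter> I v = {e \<in> edges H. e = {u, v}}"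
      unfolding I_def by blast
    then have "I u \<inter> I v = (if {u, v} \<in> edges H then {{u, v}} else {})" by auto
    moreover have "f u \<inter> f v = Inl ` (I u \<inter> I v)" using that unfolding f_def by auto
    ultimately show ?thesis by simp
  qed
  have "inj_on f (verts H)"
  proof (rule inj_onI, rule ccontr)
    fix u v assume *: "u \<in> verts H" "v \<in> verts H" "f u = f v" "u \<noteq> v"
    have "card (f u \<inter> f v) \<le> 1" unfolding Int[OF *(4)] by simp
    then show False using card_f[OF *(2)] *(3) d by simp
  qed
  then have model: "intersection_model H d (\<Union>v\<in>verts H. f v) {} f"
    by (intro intersection_modelI) (auto simp: Int card_f)
  have "finite (\<Union>v\<in>verts H. f v)" using H finf by (simp add: simple_graph_def)
  then obtain h where h: "bij_betw h (\<Union>v\<in>verts H. f v) {0..<card (\<Union>v\<in>verts H. f v)}"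
    using ex_bij_betw_finite_nat by blast
  have "intersection_model H d {..<card (\<Union>v\<in>verts H. f v)} {} (\<lambda>v. h ` f v)"
    using intersection_model_image[OF model bij_betw_imp_inj_on[OF h]] bij_betw_imp_surj_on[OF h]
    by (simp add: atLeast0LessThan)
  then show ?thesis by blast
qed

section \<open>Saving a point\<close>

text \<open>
  The region \<open>U = f x1 \<union> f x2\<close> of \<open>2d\<close> points is replaced by the region \<open>F\<close> of \<open>2d - 1\<close> points.
  Points outside of \<open>U\<close> are merely renamed, by a bijection \<open>\<phi>\<close> onto the points outside of \<open>F\<close>.
  The set of a vertex \<open>v\<close> has its trace on \<open>U\<close> replaced by \<open>P v\<close>. Two vertices other than
  \<open>x1\<close>, \<open>x2\<close> share no point of \<open>U\<close>, since a leaf has only one neighbor; hence their old common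
  points survive, and new ones can arise only from the traces, which the last assumption on \<open>P\<close>
  controls.
\<close>
lemma intersection_model_surgery:
  fixes H :: "'a ugraph" and f P :: "'a \<Rightarrow> nat set"
  assumes f: "intersection_model H d {..<Suc N} {} f"
    and x: "x1 \<in> verts H" "x2 \<in> verts H" "x1 \<noteq> x2" "f x1 \<inter> f x2 = {}"
    and y1: "\<And>v. v \<in> verts H \<Longrightarrow> v \<noteq> x1 \<Longrightarrow> f v \<inter> f x1 \<noteq> {} \<longleftrightarrow> v = y1"
    and y2: "\<And>v. v \<in> verts H \<Longrightarrow> v \<noteq> x2 \<Longrightarrow> f v \<inter> f x2 \<noteq> {} \<longleftrightarrow> v = y2"
    and A: "A \<subseteq> F" "card A = d" and B: "B \<subseteq> F" "card B = d" and AB: "A \<noteq> B"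
    and F: "F \<subseteq> {..<N}" "Suc (card F) = 2 * d"
    and P: "\<And>v. v \<in> verts H - {x1, x2} \<Longrightarrow> P v \<subseteq> F"
      "\<And>v. v \<in> verts H - {x1, x2} \<Longrightarrow> card (P v) = card (f v \<inter> (f x1 \<union> f x2))"
      "\<And>v. v \<in> verts H - {x1, x2} \<Longrightarrow> P v \<inter> A \<noteq> {} \<longleftrightarrow> v = y1"
      "\<And>v. v \<in> verts H - {x1, x2} \<Longrightarrow> P v \<inter> B \<noteq> {} \<longleftrightarrow> v = y2"
      "\<And>v. v \<in> verts H - {x1, x2} \<Longrightarrow> P v \<noteq> A \<and> P v \<noteq> B"
      "\<And>u v. u \<in> verts H - {x1, x2} \<Longrightarrow> v \<in> verts H - {x1, x2} \<Longrightarrow> u \<noteq> v \<Longrightarrow>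
        P u \<inter> P v \<noteq> {} \<Longrightarrow> f u \<inter> f v \<noteq> {}"
  shows "\<exists>g. intersection_model H d {..<N} {A, B} g"
proof -
  define U where "U = f x1 \<union> f x2"
  define V where "V = verts H - {x1, x2}"
  note inj = intersection_modelD(1)[OF f] and fN = intersection_modelD(2)[OF f]
    and cf = intersection_modelD(3)[OF f]
  have e: "{u, v} \<in> edges H \<longleftrightarrow> f u \<inter> f v \<noteq> {}" if "u \<in> verts H" "v \<in> verts H" "u \<noteq> v" for u v
    using intersection_modelD(4)[OF f that] by simp
  have finf: "finite (f v)" if "v \<in> verts H" for v
    using fN[OF that] finite_subset by blast
  have finF: "finite F" using F(1) finite_subset by blast
  have cU: "card U = 2 * d"
    unfolding U_def using x finf cf by (subst card_Un_disjoint) auto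
  have UN: "U \<subseteq> {..<Suc N}" using x fN unfolding U_def by blast
  have "card ({..<Suc N} - U) = card ({..<N} - F)"
    using UN F cU finF finite_subset[OF UN] by (simp add: card_Diff_subset)
  then obtain \<phi> where \<phi>: "bij_betw \<phi> ({..<Suc N} - U) ({..<N} - F)"
    using finite_same_card_bij by blast
  \<comment> \<open>\<open>Q v\<close> is the part of the new set outside of \<open>F\<close>, a copy of \<open>f v - U\<close>.\<close>
  define Q where "Q v = \<phi> ` (f v - U)" for v
  have sub: "f v - U \<subseteq> {..<Suc N} - U" if "v \<in> V" for v
    using fN that by (auto simp: V_def)
  have QN: "Q v \<subseteq> {..<N} - F" if "v \<in> V" for v
    using sub[OF that] \<phi> unfolding Q_def bij_betw_def by blast
  have cQ: "card (Q v) = card (f v - U)" if "v \<in> V" for v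
    unfolding Q_def using sub[OF that] \<phi> by (meson bij_betw_def card_image inj_on_subset)
  have Qeq: "Q u = Q v \<longleftrightarrow> f u - U = f v - U" if "u \<in> V" "v \<in> V" for u v
    unfolding Q_def using sub that inj_on_image_eq_iff[OF bij_betw_imp_inj_on[OF \<phi>]] by simp
  have QInt: "Q u \<inter> Q v = {} \<longleftrightarrow> (f u - U) \<inter> (f v - U) = {}" if "u \<in> V" "v \<in> V" for u v
    using inj_on_image_Int[OF bij_betw_imp_inj_on[OF \<phi>] sub[OF that(1)] sub[OF that(2)]]
    unfolding Q_def by (metis image_is_empty)
  have PF: "P v \<subseteq> F" if "v \<in> V" for v using P(1)[of v] that by (auto simp: V_def)
  define g where "g v = (if v = x1 then A else if v = x2 then B else Q v \<union> P v)" for v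
  have g1: "g x1 = A" and g2: "g x2 = B" and gV: "\<And>v. v \<in> V \<Longrightarrow> g v = Q v \<union> P v"
    using x by (auto simp: g_def V_def)
  have gF: "g v \<inter> F = P v" and gnF: "g v - F = Q v" if "v \<in> V" for v
    using gV[OF that] QN[OF that] PF[OF that] by auto
  have vcases: "v = x1 \<or> v = x2 \<or> v \<in> V" if "v \<in> verts H" for v
    using that by (auto simp: V_def)
  have VH: "v \<in> verts H" "v \<noteq> x1" "v \<noteq> x2" if "v \<in> V" for v
    using that by (auto simp: V_def)
  have meetU: "v = y1 \<or> v = y2" if "v \<in> V" "f v \<inter> U \<noteq> {}" for v
    using that VH[OF that(1)] y1[of v] y2[of v] by (auto simp: U_def)
  have card_g: "g v \<subseteq> {..<N} \<and> card (g v) = d" if "v \<in> verts H" for v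
    using vcases[OF that]
  proof (elim disjE)
    assume v: "v \<in> V"
    have "card (g v) = card (Q v) + card (P v)"
      unfolding gV[OF v] using QN[OF v] PF[OF v] finF
      by (intro card_Un_disjoint) (auto intro: finite_subset)
    also have "\<dots> = card (f v - U) + card (f v \<inter> U)"
      using cQ[OF v] P(2)[of v] v by (simp add: V_def U_def)
    also have "\<dots> = card (f v)"
      using finf[OF that] by (metis card_Diff_subset_Int add.commute card_Int_Diff finite_Int)
    finally show ?thesis using gV[OF v] QN[OF v] PF[OF v] F cf[OF that] by auto
  qed (use A B F g1 g2 in auto)
  have gA: "g v \<noteq> A" "g v \<noteq> B" if "v \<in> V" for v
    using gF[OF that] P(5)[of v] that A B by (auto simp: V_def)
  \<comment> \<open>Equal new sets have equal traces on \<open>F\<close>. If these meet \<open>A\<close> or \<open>B\<close>, both vertices are the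
    neighbor of the same leaf; otherwise both old sets lie outside of \<open>U\<close>, where \<open>\<phi>\<close> is injective.\<close>
  have inj_g: "inj_on g (verts H)"
  proof (rule inj_onI)
    fix u v assume u: "u \<in> verts H" and v: "v \<in> verts H" and eq: "g u = g v"
    have "u = v" if uv: "u \<in> V" "v \<in> V"
    proof -
      have "P u = P v" using eq gF uv by metis
      then have y: "u = y1 \<longleftrightarrow> v = y1" "u = y2 \<longleftrightarrow> v = y2"
        using P(3,4) uv unfolding V_def by metis+
      show ?thesis
      proof (cases "f u \<inter> U = {} \<and> f v \<inter> U = {}")
        case True
        have "f u - U = f v - U" using eq gnF Qeq uv by metis
        then have "f u = f v" using True by blast
        then show ?thesis using inj u v by (auto dest: inj_onD)
      next
        case False
        then show ?thesis using meetU uv y by blast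
      qed
    qed
    then show "u = v"
      using vcases[OF u] vcases[OF v] gA[of u] gA[of v] eq g1 g2 AB by metis
  qed
  have adj_g: "{u, v} \<in> edges H \<longleftrightarrow> g u \<inter> g v \<noteq> {} \<and> {g u, g v} \<noteq> {A, B}"
    if "u \<in> verts H" "v \<in> verts H" "u \<noteq> v" for u v
  proof -
    note uv = that
    have x1V: "{x1, v} \<in> edges H \<longleftrightarrow> g x1 \<inter> g v \<noteq> {} \<and> {g x1, g v} \<noteq> {A, B}" if v: "v \<in> V" for v
    proof -
      have "{x1, v} \<in> edges H \<longleftrightarrow> v = y1"
        using e[of v x1] y1[of v] VH[OF v] x by (metis insert_commute)
      also have "\<dots> \<longleftrightarrow> g v \<inter> A \<noteq> {}" using P(3)[of v] gF[OF v] A v by (auto simp: V_def)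
      finally show ?thesis using g1 gA[OF v] by (auto simp: doubleton_eq_iff)
    qed
    have x2V: "{x2, v} \<in> edges H \<longleftrightarrow> g x2 \<inter> g v \<noteq> {} \<and> {g x2, g v} \<noteq> {A, B}" if v: "v \<in> V" for v
    proof -
      have "{x2, v} \<in> edges H \<longleftrightarrow> v = y2"
        using e[of v x2] y2[of v] VH[OF v] x by (metis insert_commute)
      also have "\<dots> \<longleftrightarrow> g v \<inter> B \<noteq> {}" using P(4)[of v] gF[OF v] B v by (auto simp: V_def)
      finally show ?thesis using g2 gA[OF v] by (auto simp: doubleton_eq_iff)
    qed
    have VV: "{u, v} \<in> edges H \<longleftrightarrow> g u \<inter> g v \<noteq> {} \<and> {g u, g v} \<noteq> {A, B}"
      if u: "u \<in> V" and v: "v \<in> V" and ne: "u \<noteq> v" for u v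
    proof -
      have "f u \<inter> f v \<inter> U = {}"
        using y1[of u] y1[of v] y2[of u] y2[of v] VH[OF u] VH[OF v] ne by (auto simp: U_def)
      then have "f u \<inter> f v \<noteq> {} \<longleftrightarrow> Q u \<inter> Q v \<noteq> {}" using QInt[OF u v] by blast
      moreover have "g u \<inter> g v = (Q u \<inter> Q v) \<union> (P u \<inter> P v)"
        using gV u v QN PF by blast
      moreover have "P u \<inter> P v \<noteq> {} \<Longrightarrow> f u \<inter> f v \<noteq> {}"
        using P(6)[of u v] u v ne by (simp add: V_def)
      ultimately have "g u \<inter> g v \<noteq> {} \<longleftrightarrow> f u \<inter> f v \<noteq> {}" by blast
      then show ?thesis using e[of u v] VH u v ne gA by (auto simp: doubleton_eq_iff)
    qed
    have "{x1, x2} \<notin> edges H" using e[of x1 x2] x by blast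
    then have pair: "{u, v} \<notin> edges H \<and> {g u, g v} = {A, B}" if "{u, v} = {x1, x2}"
      using that g1 g2 by (auto simp: doubleton_eq_iff insert_commute)
    consider "{u, v} = {x1, x2}" | "u = x1" "v \<in> V" | "u = x2" "v \<in> V"
      | "v = x1" "u \<in> V" | "v = x2" "u \<in> V" | "u \<in> V" "v \<in> V"
      using vcases[OF uv(1)] vcases[OF uv(2)] uv(3) insert_commute[of x1 x2 "{}"] by blast
    then show ?thesis
    proof cases
      case 1
      then show ?thesis using pair by blast
    next
      case 4
      then show ?thesis using x1V[of u] by (simp add: insert_commute Int_commute)
    next
      case 5
      then show ?thesis using x2V[of u] by (simp add: insert_commute Int_commute)
    qed (use x1V x2V VV uv(3) in simp_all)
  qed
  have "intersection_model H d {..<N} {A, B} g"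
    using inj_g card_g adj_g by (intro intersection_modelI) auto
  then show ?thesis by blast
qed
section \<open>How much a leaf overlaps its neighbor\<close>

lemma leaf_meets_only_neighbor:
  assumes H: "simple_graph H" and f: "intersection_model H d M {} f"
    and x: "x \<in> verts H" "neighbors H x = {y}" and v: "v \<in> verts H" "v \<noteq> x"
  shows "f v \<inter> f x \<noteq> {} \<longleftrightarrow> v = y"
proof -
  have "f v \<inter> f x \<noteq> {} \<longleftrightarrow> {x, v} \<in> edges H"
    using intersection_modelD(4)[OF f x(1) v(1)] v by (auto simp: Int_commute)
  also have "\<dots> \<longleftrightarrow> v \<in> neighbors H x" using v by (simp add: neighbors_def)
  finally show ?thesis using x by simp
qed

lemma stability_number_attained:
  assumes "finite (verts G)"
  obtains S where "stable_set G S" "card S = stability_number G"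
proof -
  have "{S. stable_set G S} \<subseteq> Pow (verts G)" by (auto simp: stable_set_def)
  then have "finite {S. stable_set G S}" using assms by (meson finite_Pow_iff finite_subset)
  moreover have "{} \<in> {S. stable_set G S}" by (simp add: stable_set_def)
  ultimately have "stability_number G \<in> card ` {S. stable_set G S}"
    unfolding stability_number_def by (intro Max_in) auto
  then show thesis using that by auto
qed

lemma finite_neighbors: "simple_graph H \<Longrightarrow> finite (neighbors H v)"
  by (simp add: neighbors_def simple_graph_def)

lemma stability_number_neighbors_le_degree:
  assumes "simple_graph H"
  shows "stability_number (induced_subgraph H (neighbors H y)) \<le> degree H y"
proof -
  have fin: "finite (neighbors H y)" using assms by (rule finite_neighbors)
  then obtain S where S: "stable_set (induced_subgraph H (neighbors H y)) S"
    "card S = stability_number (induced_subgraph H (neighbors H y))"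
    using stability_number_attained[of "induced_subgraph H (neighbors H y)"]
    by (auto simp: induced_subgraph_def)
  then have "S \<subseteq> neighbors H y" by (simp add: stable_set_def induced_subgraph_def)
  then show ?thesis using S(2) fin by (simp add: degree_def card_mono flip: S(2))
qed

text \<open>
  The members of a maximum stable set of \<open>N(y)\<close> other than the leaf \<open>x\<close> have pairwise disjoint
  sets, which also miss \<open>f x\<close>. Each of them takes a point of \<open>f y\<close> away from the overlap with
  \<open>f x\<close>.
\<close>
lemma card_leaf_overlap_le:
  assumes H: "simple_graph H" and f: "intersection_model H d M {} f" and M: "finite M"
    and x: "x \<in> verts H" "neighbors H x = {y}"
  shows "card (f y \<inter> f x) + stability_number (induced_subgraph H (neighbors H y)) \<le> d + 1"
proof -
  let ?K = "induced_subgraph H (neighbors H y)"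
  have y: "y \<in> verts H" using x(2) by (auto simp: neighbors_def)
  have "finite (verts ?K)" using H by (simp add: induced_subgraph_def finite_neighbors)
  then obtain S where S: "stable_set ?K S" and cS: "card S = stability_number ?K"
    by (rule stability_number_attained)
  have SN: "S \<subseteq> neighbors H y" using S by (simp add: stable_set_def induced_subgraph_def)
  have Sv: "s \<in> verts H" "{y, s} \<in> edges H" "s \<noteq> y" if "s \<in> S" for s
    using SN that simple_graph_edgeD(3)[OF H, of y s] by (auto simp: neighbors_def)
  have nonadj: "{s, t} \<notin> edges H" if "s \<in> S" "t \<in> S" for s t
    using S SN that by (auto simp: stable_set_def induced_subgraph_def)
  have disj: "f s \<inter> f t = {}" if "s \<in> S" "t \<in> S" "s \<noteq> t" for s t
    using intersection_modelD(4)[OF f Sv(1)[OF that(1)] Sv(1)[OF that(2)]] nonadj that by simp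
  have off: "f s \<inter> f x = {}" if "s \<in> S" "s \<noteq> x" for s
    using leaf_meets_only_neighbor[OF H f x Sv(1)] Sv(3) that by blast
  have "\<forall>s\<in>S. \<exists>p. p \<in> f s \<inter> f y"
    using intersection_modelD(4)[OF f y Sv(1)] Sv by blast
  then obtain c where c: "\<And>s. s \<in> S \<Longrightarrow> c s \<in> f s \<inter> f y" by metis
  have finy: "finite (f y)" using intersection_modelD(2)[OF f y] M by (rule finite_subset)
  have finS: "finite S" using SN H by (meson finite_neighbors finite_subset)
  have "card (S - {x}) \<le> card (f y - f x)"
  proof (rule card_inj_on_le)
    show "inj_on c (S - {x})"
    proof (rule inj_onI, rule ccontr)
      fix s t assume "s \<in> S - {x}" "t \<in> S - {x}" "c s = c t" "s \<noteq> t"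
      then show False using c[of s] c[of t] disj[of s t] by auto
    qed
    show "c ` (S - {x}) \<subseteq> f y - f x" using c off by fastforce
  qed (use finy in simp)
  moreover have "card (f y - f x) + card (f y \<inter> f x) = d"
    using finy intersection_modelD(3)[OF f y] by (metis add.commute card_Int_Diff)
  moreover have "card S \<le> card (S - {x}) + 1"
    by (cases "x \<in> S") (simp_all add: card_Diff_singleton)
  ultimately show ?thesis using cS by linarith
qed

section \<open>Choosing the new traces\<close>

text \<open>
  \<open>P1\<close> uses up the points of \<open>A - B\<close> first, which \<open>P2\<close> must avoid anyway; only a remainder of
  fewer than \<open>a1\<close> points competes with \<open>P2\<close> for the points of \<open>F\<close> outside of \<open>A \<union> B\<close>. Hence
  \<open>a1 + a2 \<le> d\<close> suffices for disjointness.
\<close>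
lemma traces_exist:
  assumes F: "finite F" "Suc (card F) = 2 * d"
    and A: "A \<subseteq> F" "card A = d" and B: "B \<subseteq> F" "card B = d" and AB: "A \<noteq> B"
    and a: "1 \<le> a1" "a1 < d" "1 \<le> a2" "a2 < d"
  shows "\<exists>P1 P2. P1 \<subseteq> F - B \<and> P1 \<inter> A \<noteq> {} \<and> card P1 = a1 \<and>
                 P2 \<subseteq> F - A \<and> P2 \<inter> B \<noteq> {} \<and> card P2 = a2 \<and>
                 (a1 + a2 \<le> d \<longrightarrow> P1 \<inter> P2 = {})"
proof -
  have fin: "finite A" "finite B" using A B F finite_subset by blast+
  have cards: "card (F - A) = d - 1" "card (F - B) = d - 1"
    using F A B fin by (simp_all add: card_Diff_subset)
  have "\<not> A \<subseteq> B" "\<not> B \<subseteq> A"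
    using A B AB fin by (metis card_subset_eq)+
  then obtain p q where p: "p \<in> A - B" and q: "q \<in> B - A" by blast
  have "card (A - B) \<ge> 1" using p fin by (simp add: Suc_le_eq card_gt_0_iff) blast
  obtain P1 where P1: "P1 \<subseteq> F - B" "p \<in> P1" "card P1 = a1" "P1 \<subseteq> A - B \<or> A - B \<subseteq> P1"
  proof (cases "a1 \<le> card (A - B)")
    case True
    then obtain P where "{p} \<subseteq> P" "P \<subseteq> A - B" "card P = a1"
      using exists_subset_between[of "{p}" a1 "A - B"] p a fin by auto
    then show thesis using that[of P] A by blast
  next
    case False
    have "A - B \<subseteq> F - B" "finite (F - B)" "card (A - B) \<le> a1" "a1 \<le> card (F - B)"
      using A(1) F(1) False cards(2) a(2) by auto
    then obtain P where "A - B \<subseteq> P" "P \<subseteq> F - B" "card P = a1"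
      using exists_subset_between by metis
    then show thesis using that[of P] p by blast
  qed
  \<comment> \<open>The points from which \<open>P2\<close> may be chosen.\<close>
  define R where "R = (if a1 + a2 \<le> d then F - A - P1 else F - A)"
  have "a2 \<le> card R"
  proof (cases "a1 + a2 \<le> d")
    case True
    have "F - A - P1 = (F - A) - (P1 - A)" by blast
    moreover have finP1: "finite P1" using P1(1) F(1) by (meson finite_Diff finite_subset)
    moreover have "P1 - A \<subseteq> F - A" using P1(1) by blast
    ultimately have cR: "card R = d - 1 - card (P1 - A)"
      using True cards by (simp add: R_def card_Diff_subset)
    have "card (P1 - A) + 1 \<le> a1 \<and> card (P1 - A) + a2 \<le> d - 1"
      using P1(4)
    proof
      assume "P1 \<subseteq> A - B"
      then have "P1 - A = {}" by blast
      then have "card (P1 - A) = 0" by (simp only: card.empty)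
      then show ?thesis using a by linarith
    next
      assume "A - B \<subseteq> P1"
      then have "P1 - A = P1 - (A - B)" using P1(1) by blast
      then have "card (P1 - A) = a1 - card (A - B)"
        using card_Diff_subset[OF _ \<open>A - B \<subseteq> P1\<close>] P1(3) fin by (simp only: finite_Diff)
      then show ?thesis using \<open>card (A - B) \<ge> 1\<close> True a by linarith
    qed
    then show ?thesis using cR by linarith
  next
    case False
    then show ?thesis using a cards by (simp add: R_def)
  qed
  moreover have "{q} \<subseteq> R" using q B(1) P1(1) by (auto simp: R_def)
  moreover have "finite R" using F by (simp add: R_def)
  ultimately obtain P2 where P2: "{q} \<subseteq> P2" "P2 \<subseteq> R" "card P2 = a2"
    using exists_subset_between[of "{q}" a2 R] a by auto
  have "P2 \<subseteq> F - A" "a1 + a2 \<le> d \<longrightarrow> P1 \<inter> P2 = {}"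
    using P2(2) by (auto simp: R_def split: if_splits)
  moreover have "P1 \<inter> A \<noteq> {}" "P2 \<inter> B \<noteq> {}" using P1(2) P2(1) p q by blast+
  ultimately show ?thesis using P1 P2 by blast
qed

text \<open>
  The old trace of \<open>y\<close> on \<open>U\<close> meets both leaves, so it has at least two points. The new trace can
  therefore contain a point \<open>p\<close> of \<open>A - B\<close> and a point \<open>q\<close> of \<open>B - A\<close>; this makes it meet both
  sets and differ from both.
\<close>
lemma model_after_deletion_common_neighbor:
  fixes H :: "'a ugraph" and f :: "'a \<Rightarrow> nat set"
  assumes H: "simple_graph H" and f: "intersection_model H d {..<Suc N} {} f"
    and x: "x1 \<in> verts H" "x2 \<in> verts H" "x1 \<noteq> x2" "neighbors H x1 = {y}" "neighbors H x2 = {y}"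
    and A: "A \<subseteq> F" "card A = d" and B: "B \<subseteq> F" "card B = d" and AB: "A \<noteq> B"
    and F: "F \<subseteq> {..<N}" "Suc (card F) = 2 * d"
  shows "\<exists>g. intersection_model H d {..<N} {A, B} g"
proof -
  have y: "y \<in> verts H" "y \<noteq> x1" "y \<noteq> x2"
    using x simple_graph_edgeD[OF H, of x1 y] simple_graph_edgeD[OF H, of x2 y]
    by (auto simp: neighbors_def)
  note meet1 = leaf_meets_only_neighbor[OF H f x(1,4)] and meet2 = leaf_meets_only_neighbor[OF H f x(2,5)]
  have disj: "f x1 \<inter> f x2 = {}" using meet2[OF x(1,3)] y by blast
  have finF: "finite F" using F(1) finite_subset by blast
  then have fin: "finite A" "finite B" using A B finite_subset by blast+
  have "\<not> A \<subseteq> B" "\<not> B \<subseteq> A"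
    using A B AB fin by (metis card_subset_eq)+
  then obtain p q where p: "p \<in> A - B" and q: "q \<in> B - A" by blast
  obtain p' q' where "p' \<in> f y \<inter> f x1" "q' \<in> f y \<inter> f x2"
    using meet1[OF y(1,2)] meet2[OF y(1,3)] by blast
  then have pq': "{p', q'} \<subseteq> f y \<inter> (f x1 \<union> f x2)" "p' \<noteq> q'" using disj by blast+
  let ?a = "card (f y \<inter> (f x1 \<union> f x2))"
  have finy: "finite (f y)" using intersection_modelD(2)[OF f y(1)] finite_subset by blast
  have "card {p', q'} \<le> ?a" using pq'(1) finy by (intro card_mono) auto
  moreover have "?a \<le> d" using intersection_modelD(3)[OF f y(1)] finy by (metis card_mono inf_le1)
  ultimately have "card {p, q} \<le> ?a" "?a \<le> card F"
    using p q pq'(2) F(2) by (auto simp: card_insert_if)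
  then obtain P where P: "{p, q} \<subseteq> P" "P \<subseteq> F" "card P = ?a"
    using exists_subset_between[of "{p, q}" ?a F] p q A B finF by auto
  have U0: "f v \<inter> (f x1 \<union> f x2) = {}" if "v \<in> verts H - {x1, x2}" "v \<noteq> y" for v
    using meet1[of v] meet2[of v] that by auto
  have ne: "A \<noteq> {}" "B \<noteq> {}" using p q by auto
  show ?thesis
  proof (rule intersection_model_surgery[OF f x(1-3) disj meet1 meet2 A B AB F,
        where P = "\<lambda>v. if v = y then P else {}"])
    fix v assume v: "v \<in> verts H - {x1, x2}"
    show "card (if v = y then P else {}) = card (f v \<inter> (f x1 \<union> f x2))"
      using P(3) U0[OF v] by auto
  qed (use P(1,2) p q ne in \<open>auto split: if_splits\<close>)
qed

text \<open>
  For distinct neighbors the new traces must separate \<open>A\<close> from \<open>B\<close>. They cannot coincide with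
  \<open>A\<close> or \<open>B\<close>, because these meet and each trace avoids one of them.
\<close>
lemma model_after_deletion_distinct_neighbors:
  fixes H :: "'a ugraph" and f :: "'a \<Rightarrow> nat set"
  assumes H: "simple_graph H" and f: "intersection_model H d {..<Suc N} {} f"
    and x: "x1 \<in> verts H" "x2 \<in> verts H" "x1 \<noteq> x2" "neighbors H x1 = {y1}" "neighbors H x2 = {y2}"
    and y: "y1 \<noteq> y2" "y1 \<noteq> x2" "y2 \<noteq> x1"
    and overlap: "card (f y1 \<inter> f x1) < d" "card (f y2 \<inter> f x2) < d"
      "card (f y1 \<inter> f x1) + card (f y2 \<inter> f x2) \<le> d \<or> {y1, y2} \<in> edges H"
    and A: "A \<subseteq> F" "card A = d" and B: "B \<subseteq> F" "card B = d" and AB: "A \<noteq> B"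
    and F: "F \<subseteq> {..<N}" "Suc (card F) = 2 * d"
  shows "\<exists>g. intersection_model H d {..<N} {A, B} g"
proof -
  have yv: "y1 \<in> verts H" "y1 \<noteq> x1" "y2 \<in> verts H" "y2 \<noteq> x2"
    using x simple_graph_edgeD[OF H, of x1 y1] simple_graph_edgeD[OF H, of x2 y2]
    by (auto simp: neighbors_def)
  note meet1 = leaf_meets_only_neighbor[OF H f x(1,4)] and meet2 = leaf_meets_only_neighbor[OF H f x(2,5)]
  have disj: "f x1 \<inter> f x2 = {}" using meet2[OF x(1,3)] y(3) by blast
  have finF: "finite F" using F(1) finite_subset by blast
  have finf: "finite (f v)" if "v \<in> verts H" for v
    using intersection_modelD(2)[OF f that] finite_subset by blast
  let ?a1 = "card (f y1 \<inter> f x1)" and ?a2 = "card (f y2 \<inter> f x2)"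
  have "1 \<le> ?a1" "1 \<le> ?a2"
    using meet1[OF yv(1,2)] meet2[OF yv(3,4)] finf yv by (simp_all add: Suc_le_eq card_gt_0_iff)
  then obtain P1 P2 where P1: "P1 \<subseteq> F - B" "P1 \<inter> A \<noteq> {}" "card P1 = ?a1"
    and P2: "P2 \<subseteq> F - A" "P2 \<inter> B \<noteq> {}" "card P2 = ?a2"
    and P12: "?a1 + ?a2 \<le> d \<longrightarrow> P1 \<inter> P2 = {}"
    using traces_exist[OF finF F(2) A B AB _ overlap(1) _ overlap(2)] by metis
  have adj: "f y1 \<inter> f y2 \<noteq> {}" if "P1 \<inter> P2 \<noteq> {}"
    using that P12 overlap(3) intersection_modelD(4)[OF f yv(1,3) y(1)] by blast
  \<comment> \<open>Two disjoint \<open>d\<close>-sets would not fit into \<open>2d - 1\<close> points.\<close>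
  have "card (A \<union> B) \<le> card F" using A B finF by (intro card_mono) auto
  then have "A \<inter> B \<noteq> {}"
    using A B F finF by (metis Suc_n_not_le_n card_Un_disjoint finite_subset mult_2)
  then have neq: "P1 \<noteq> A" "P2 \<noteq> B" "P1 \<noteq> B" "P2 \<noteq> A" using P1 P2 by blast+
  have ne: "A \<noteq> {}" "B \<noteq> {}" using P1(2) P2(2) by auto
  have U1: "f y1 \<inter> (f x1 \<union> f x2) = f y1 \<inter> f x1" using meet2[OF yv(1) y(2)] y(1) by blast
  have U2: "f y2 \<inter> (f x1 \<union> f x2) = f y2 \<inter> f x2" using meet1[OF yv(3) y(3)] y(1) by blast
  have U0: "f v \<inter> (f x1 \<union> f x2) = {}" if "v \<in> verts H - {x1, x2}" "v \<noteq> y1" "v \<noteq> y2" for v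
    using meet1[of v] meet2[of v] that by auto
  show ?thesis
  proof (rule intersection_model_surgery[OF f x(1-3) disj meet1 meet2 A B AB F,
        where P = "\<lambda>v. if v = y1 then P1 else if v = y2 then P2 else {}"])
    fix v assume v: "v \<in> verts H - {x1, x2}"
    show "card (if v = y1 then P1 else if v = y2 then P2 else {}) = card (f v \<inter> (f x1 \<union> f x2))"
      using P1(3) P2(3) U0[OF v] U1 U2 by auto
    show "(if v = y1 then P1 else if v = y2 then P2 else {}) \<inter> A \<noteq> {} \<longleftrightarrow> v = y1"
      "(if v = y1 then P1 else if v = y2 then P2 else {}) \<inter> B \<noteq> {} \<longleftrightarrow> v = y2"
      using P1 P2 y(1) by auto
    show "(if v = y1 then P1 else if v = y2 then P2 else {}) \<subseteq> F"
      using P1(1) P2(1) by auto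
    show "(if v = y1 then P1 else if v = y2 then P2 else {}) \<noteq> A \<and>
          (if v = y1 then P1 else if v = y2 then P2 else {}) \<noteq> B"
      using neq ne by auto
    fix u assume "u \<in> verts H - {x1, x2}" "u \<noteq> v"
      "(if u = y1 then P1 else if u = y2 then P2 else {}) \<inter>
       (if v = y1 then P1 else if v = y2 then P2 else {}) \<noteq> {}"
    then show "f u \<inter> f v \<noteq> {}"
      using adj by (auto simp: Int_commute split: if_splits)
  qed
qed

section \<open>Graphs with two suitable leaves are deletion-normal\<close>

lemma distance_le_1:
  assumes "simple_graph H" "{u, v} \<in> edges H"
  shows "distance H u v \<le> 1"
proof -
  have "path_between H u v [u, v]"
    using assms simple_graph_edgeD[OF assms] by (auto simp: path_between_def)
  then have "distance H u v \<le> enat (length [u, v] - 1)"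
    unfolding distance_def by (intro INF_lower) simp
  then show ?thesis by (simp add: one_enat_def)
qed

theorem theorem5p1:
  fixes H :: "'a ugraph" and d :: nat and x1 x2 y1 y2 :: 'a
  assumes "simple_graph H"
    and "max_degree H = d" and "d \<ge> 1"
    and "leaf H x1" and "leaf H x2" and "x1 \<noteq> x2"
    and "neighbors H x1 = {y1}" and "neighbors H x2 = {y2}"
    and "y1 = y2
       \<or> ({y1, y2} \<in> edges H \<and> distance H x1 x2 = 3)
       \<or> stability_number (induced_subgraph H (neighbors H y1))
           + stability_number (induced_subgraph H (neighbors H y2)) \<ge> d + 2"
  shows "deletion_normal H"
proof -
  note H = assms(1) and N1 = assms(7) and N2 = assms(8) and abc = assms(9)
  let ?\<alpha> = "\<lambda>y. stability_number (induced_subgraph H (neighbors H y))"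
  have x: "x1 \<in> verts H" "x2 \<in> verts H" using assms(4,5) by (auto simp: leaf_def)
  have e: "{x1, y1} \<in> edges H" "{x2, y2} \<in> edges H" using N1 N2 by (auto simp: neighbors_def)
  have yv: "y1 \<in> verts H" "y1 \<noteq> x1" "y2 \<in> verts H" "y2 \<noteq> x2"
    using simple_graph_edgeD[OF H e(1)] simple_graph_edgeD[OF H e(2)] by auto
  have deg: "degree H v \<le> d" if "v \<in> verts H" for v
    using degree_le_max_degree[OF H that] assms(2) by simp
  have \<alpha>d: "?\<alpha> v \<le> d" if "v \<in> verts H" for v
    using stability_number_neighbors_le_degree[OF H, of v] deg[OF that] by linarith
  \<comment> \<open>Adjacent leaves form a component \<open>K\<^sub>2\<close>, so that \<open>y1 = x2\<close> and \<open>y2 = x1\<close>; each of the three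
    alternatives excludes this.\<close>
  have nonadj: "{x1, x2} \<notin> edges H"
  proof
    assume x12: "{x1, x2} \<in> edges H"
    then have "x2 \<in> neighbors H x1" "x1 \<in> neighbors H x2"
      using x by (auto simp: neighbors_def insert_commute)
    then have eq: "y1 = x2" "y2 = x1" using N1 N2 by auto
    have "\<not> 3 \<le> (1 :: enat)" by (simp add: one_enat_def numeral_eq_enat)
    then have "distance H x1 x2 \<noteq> 3" using distance_le_1[OF H x12] by metis
    then have "d + 2 \<le> ?\<alpha> y1 + ?\<alpha> y2" using abc eq \<open>x1 \<noteq> x2\<close> by auto
    moreover have "?\<alpha> y1 \<le> 1" "?\<alpha> y2 \<le> 1"
      using stability_number_neighbors_le_degree[OF H, of y1]
        stability_number_neighbors_le_degree[OF H, of y2] assms(4,5) eq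
      by (auto simp: leaf_def)
    ultimately show False using \<open>d \<ge> 1\<close> by linarith
  qed
  have yx: "y1 \<noteq> x2" "y2 \<noteq> x1" using nonadj e by (auto simp: insert_commute)
  have d2: "2 \<le> d"
  proof (cases "y1 = y2 \<or> {y1, y2} \<in> edges H")
    case True
    then have "(if y1 = y2 then x2 else y2) \<in> neighbors H y1"
      using e(2) x(2) yv(3) by (auto simp: neighbors_def insert_commute)
    then obtain z where "z \<noteq> x1" "z \<in> neighbors H y1"
      using yx(2) \<open>x1 \<noteq> x2\<close> by (metis (full_types))
    moreover have "x1 \<in> neighbors H y1" using e x by (auto simp: neighbors_def insert_commute)
    ultimately have "card {x1, z} \<le> degree H y1"
      unfolding degree_def using finite_neighbors[OF H] by (intro card_mono) auto
    then show ?thesis using deg[OF yv(1)] \<open>z \<noteq> x1\<close> by simp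
  next
    case False
    then have "d + 2 \<le> ?\<alpha> y1 + ?\<alpha> y2" using abc by auto
    then show ?thesis using \<alpha>d[OF yv(1)] \<alpha>d[OF yv(3)] by linarith
  qed
  define N0 where "N0 = (LEAST N. \<exists>f. intersection_model H d {..<N :: nat} {} f)"
  have "\<exists>N f. intersection_model H d {..<N :: nat} {} f"
    using H eq_imp_le[OF assms(2)] d2 by (rule intersection_model_exists)
  then have "\<exists>f. intersection_model H d {..<N0} {} f"
    unfolding N0_def by (rule LeastI_ex)
  then obtain f where f0: "intersection_model H d {..<N0} {} f" ..
  have "card (f x1 \<union> f x2) = 2 * d" "f x1 \<union> f x2 \<subseteq> {..<N0}"
  proof -
    have sub: "f x1 \<subseteq> {..<N0}" "f x2 \<subseteq> {..<N0}" using intersection_modelD(2)[OF f0] x by auto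
    then show "f x1 \<union> f x2 \<subseteq> {..<N0}" by simp
    have "f x1 \<inter> f x2 = {}" using intersection_modelD(4)[OF f0 x \<open>x1 \<noteq> x2\<close>] nonadj by simp
    then show "card (f x1 \<union> f x2) = 2 * d"
      using sub intersection_modelD(3)[OF f0] x
      by (subst card_Un_disjoint) (auto intro: finite_subset)
  qed
  then have "2 * d \<le> N0" by (metis card_lessThan card_mono finite_lessThan)
  then obtain N where N: "N0 = Suc N" using d2 by (cases N0) auto
  then have f: "intersection_model H d {..<Suc N} {} f" using f0 by simp
  have none: "\<nexists>f. intersection_model H d {..<N} {} f"
    using N not_less_Least[of N "\<lambda>N. \<exists>f. intersection_model H d {..<N} {} f"] by (simp add: N0_def)
  have "\<exists>g. intersection_model H d {..<N} {A, B} g"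
    if A: "A \<subseteq> {..<N}" "card A = d" and B: "B \<subseteq> {..<N}" "card B = d"
      and AB: "A \<noteq> B" "A \<inter> B \<noteq> {}" for A B
  proof -
    have fin: "finite A" "finite B" using A B finite_subset by blast+
    have "card (A \<union> B) + card (A \<inter> B) = 2 * d" using card_Un_Int[OF fin] A B by simp
    moreover have "card (A \<inter> B) \<ge> 1" using AB fin by (simp add: Suc_le_eq card_gt_0_iff)
    ultimately have "card (A \<union> B) \<le> 2 * d - 1" by linarith
    moreover have "2 * d - 1 \<le> card {..<N}" using \<open>2 * d \<le> N0\<close> N by simp
    ultimately obtain F where F: "A \<union> B \<subseteq> F" "F \<subseteq> {..<N}" "card F = 2 * d - 1"
      using exists_subset_between[of "A \<union> B" "2 * d - 1" "{..<N}"] A B by auto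
    then have AF: "A \<subseteq> F" and BF: "B \<subseteq> F" and cF: "Suc (card F) = 2 * d" using d2 by auto
    show ?thesis
    proof (cases "y1 = y2")
      case True
      then show ?thesis
        using model_after_deletion_common_neighbor[OF H f x \<open>x1 \<noteq> x2\<close> N1 _ AF A(2) BF B(2) AB(1) F(2) cF] N2
        by simp
    next
      case False
      let ?a1 = "card (f y1 \<inter> f x1)" and ?a2 = "card (f y2 \<inter> f x2)"
      have "?a1 < d \<and> ?a2 < d \<and> (?a1 + ?a2 \<le> d \<or> {y1, y2} \<in> edges H)"
      proof (cases "{y1, y2} \<in> edges H")
        case True
        then have meet: "f y1 \<inter> f y2 \<noteq> {}"
          using intersection_modelD(4)[OF f yv(1,3) False] by simp
        have "f y2 \<inter> f x1 = {}" "f y1 \<inter> f x2 = {}"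
          using leaf_meets_only_neighbor[OF H f x(1) N1 yv(3) yx(2)]
            leaf_meets_only_neighbor[OF H f x(2) N2 yv(1) yx(1)] False by auto
        \<comment> \<open>A common point of \<open>f y1\<close> and \<open>f y2\<close> lies in neither leaf, so no overlap is all of \<open>f y1\<close>
          or \<open>f y2\<close>.\<close>
        then have "f y1 \<inter> f x1 \<subset> f y1" "f y2 \<inter> f x2 \<subset> f y2" using meet by blast+
        moreover have "finite (f y1)" "finite (f y2)"
          using intersection_modelD(2)[OF f yv(1)] intersection_modelD(2)[OF f yv(3)] finite_subset
          by blast+
        ultimately show ?thesis
          using True intersection_modelD(3)[OF f] yv by (metis psubset_card_mono)
      next
        case nonadj: False
        then have "d + 2 \<le> ?\<alpha> y1 + ?\<alpha> y2" using abc False by auto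
        moreover have "?a1 + ?\<alpha> y1 \<le> d + 1" "?a2 + ?\<alpha> y2 \<le> d + 1"
          using card_leaf_overlap_le[OF H f _ x(1) N1] card_leaf_overlap_le[OF H f _ x(2) N2] by auto
        \<comment> \<open>Summing gives \<open>a1 + a2 \<le> d\<close>. As either stability number is at most \<open>d\<close>, the other one is at
          least \<open>2\<close>, which gives \<open>a1 < d\<close> and \<open>a2 < d\<close>.\<close>
        ultimately show ?thesis using \<alpha>d[OF yv(1)] \<alpha>d[OF yv(3)] by linarith
      qed
      then show ?thesis
        using model_after_deletion_distinct_neighbors[OF H f x \<open>x1 \<noteq> x2\<close> N1 N2 False yx _ _ _
            AF A(2) BF B(2) AB(1) F(2) cF] by blast
    qed
  qed
  moreover have "d < N" using \<open>2 * d \<le> N0\<close> N d2 by linarith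
  ultimately show ?thesis
    using deletion_saturated_intersecting_graph[OF H d2 _ none] unfolding deletion_normal_def by blast
qed

end
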